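(* Let $G=H\rtimes K$ be a semidirect product of groups and let $\theta=\begin{pmatrix}\alpha&\beta\\ \gamma&\delta\end{pmatrix}\in End(G)$ be such that $\alpha: H\to H$ is invertible. Then $\theta$ is invertible (i.e. an automorphism of $G$) if and only if the map $\det_{K}(\theta)=-\gamma\alpha^{-1}\beta+\delta: K\to K$, that is, $k\mapsto \big(\gamma(\alpha^{-1}(\beta(k)))\big)^{-1}\delta(k)$, is invertible.
   Context: $K$ acts on $H$ by automorphisms, written $h^{k}$; in $G=H\rtimes K$ we have $h^{k}=khk^{-1}$ and every element of $G$ is uniquely $hk$ with $h\in H$, $k\in K$. An endomorphism $\theta$ of $G$ is identified with the matrix $\begin{pmatrix}\alpha&\beta\\ \gamma&\delta\end{pmatrix}$ of maps $\alpha:H\to H$, $\beta:K\to H$, $\gamma:H\to K$, $\delta:K\to K$ determined by $\theta(h)=\alpha(h)\gamma(h)$ and $\theta(k)=\beta(k)\delta(k)$ for all $h\in H$, $k\in K$. Here $\gamma$ and $\delta$ are group homomorphisms, while $\alpha$ and $\beta$ are only maps of sets, satisfying $\alpha(hh')=\alpha(h)\alpha(h')^{\gamma(h)}$, $\beta(kk')=\beta(k)\beta(k')^{\delta(k)}$, $\gamma(h^{k})\delta(k)=\delta(k)\gamma(h)$, $\alpha(h^{k})\beta(k)^{\gamma(h^{k})}=\beta(k)\alpha(h)^{\delta(k)}$. "Invertible" for a map means bijective. Sums and negatives of maps are pointwise: $(\phi+\psi)(u)=\phi(u)\psi(u)$, $(-\phi)(u)=\phi(u)^{-1}$; juxtaposition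 is composition. *)

theory Defs
  imports "HOL-Algebra.Bij"
begin

text \<open>The external semidirect product of \<open>H\<close> and \<open>K\<close> for an action \<open>\<phi>\<close> of \<open>K\<close> on \<open>H\<close> by
  automorphisms; \<open>\<phi> k h\<close> is what is usually written as the power of \<open>h\<close> by \<open>k\<close>, i.e. the conjugate
  of \<open>h\<close> by \<open>k\<close> in the product (see \<open>semidirect_conj\<close>). The pair \<open>(h, k)\<close> is the element \<open>hk\<close>.\<close>

definition semidirect ::
    "('a, 'c) monoid_scheme \<Rightarrow> ('b, 'd) monoid_scheme \<Rightarrow> ('b \<Rightarrow> 'a \<Rightarrow> 'a) \<Rightarrow> ('a \<times> 'b) monoid"
  where "semidirect H K \<phi> =
    \<lparr>carrier = carrier H \<times> carrier K,
     mult = (\<lambda>(h, k) (h', k'). (h \<otimes>\<^bsub>H\<^esub> \<phi> k h', k \<otimes>\<^bsub>K\<^esub> k')),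
     one = (\<one>\<^bsub>H\<^esub>, \<one>\<^bsub>K\<^esub>)\<rparr>"

definition emb_H :: "('b, 'd) monoid_scheme \<Rightarrow> 'a \<Rightarrow> 'a \<times> 'b"
  where "emb_H K h = (h, \<one>\<^bsub>K\<^esub>)"

definition emb_K :: "('a, 'c) monoid_scheme \<Rightarrow> 'b \<Rightarrow> 'a \<times> 'b"
  where "emb_K H k = (\<one>\<^bsub>H\<^esub>, k)"

text \<open>The matrix with rows \<open>\<alpha>, \<beta>\<close> and \<open>\<gamma>, \<delta>\<close> belongs to \<open>\<theta>\<close>. Only the values on the carriers are
  constrained.\<close>

definition has_matrix ::
    "('a, 'c) monoid_scheme \<Rightarrow> ('b, 'd) monoid_scheme \<Rightarrow> ('b \<Rightarrow> 'a \<Rightarrow> 'a) \<Rightarrow> ('a \<times> 'b \<Rightarrow> 'a \<times> 'b)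
      \<Rightarrow> ('a \<Rightarrow> 'a) \<Rightarrow> ('b \<Rightarrow> 'a) \<Rightarrow> ('a \<Rightarrow> 'b) \<Rightarrow> ('b \<Rightarrow> 'b) \<Rightarrow> bool"
  where "has_matrix H K \<phi> \<theta> \<alpha> \<beta> \<gamma> \<delta> \<longleftrightarrow>
    \<alpha> \<in> carrier H \<rightarrow> carrier H \<and> \<beta> \<in> carrier K \<rightarrow> carrier H \<and>
    \<gamma> \<in> carrier H \<rightarrow> carrier K \<and> \<delta> \<in> carrier K \<rightarrow> carrier K \<and>
    (\<forall>h \<in> carrier H. \<theta> (emb_H K h) = emb_H K (\<alpha> h) \<otimes>\<^bsub>semidirect H K \<phi>\<^esub> emb_K H (\<gamma> h)) \<and>
    (\<forall>k \<in> carrier K. \<theta> (emb_K H k) = emb_H K (\<beta> k) \<otimes>\<^bsub>semidirect H K \<phi>\<^esub> emb_K H (\<delta> k))"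

definition map_add :: "('b, 'd) monoid_scheme \<Rightarrow> ('u \<Rightarrow> 'b) \<Rightarrow> ('u \<Rightarrow> 'b) \<Rightarrow> 'u \<Rightarrow> 'b"
  where "map_add K f g = (\<lambda>u. f u \<otimes>\<^bsub>K\<^esub> g u)"

definition map_neg :: "('b, 'd) monoid_scheme \<Rightarrow> ('u \<Rightarrow> 'b) \<Rightarrow> 'u \<Rightarrow> 'b"
  where "map_neg K f = (\<lambda>u. inv\<^bsub>K\<^esub> (f u))"

definition det_K ::
    "('a, 'c) monoid_scheme \<Rightarrow> ('b, 'd) monoid_scheme
      \<Rightarrow> ('a \<Rightarrow> 'a) \<Rightarrow> ('b \<Rightarrow> 'a) \<Rightarrow> ('a \<Rightarrow> 'b) \<Rightarrow> ('b \<Rightarrow> 'b) \<Rightarrow> 'b \<Rightarrow> 'b"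
  where "det_K H K \<alpha> \<beta> \<gamma> \<delta> = map_add K (map_neg K (\<gamma> \<circ> inv_into (carrier H) \<alpha> \<circ> \<beta>)) \<delta>"

lemma action_simps:
  assumes "group H" "group K" "\<phi> \<in> hom K (AutoGroup H)"
  shows "k \<in> carrier K \<Longrightarrow> \<phi> k \<in> hom H H"
    and "k \<in> carrier K \<Longrightarrow> h \<in> carrier H \<Longrightarrow> \<phi> k h \<in> carrier H"
    and "k \<in> carrier K \<Longrightarrow> h \<in> carrier H \<Longrightarrow> h' \<in> carrier H \<Longrightarrow>
           \<phi> k (h \<otimes>\<^bsub>H\<^esub> h') = \<phi> k h \<otimes>\<^bsub>H\<^esub> \<phi> k h'"
    and "k \<in> carrier K \<Longrightarrow> k' \<in> carrier K \<Longrightarrow> h \<in> carrier H \<Longrightarrow>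
           \<phi> (k \<otimes>\<^bsub>K\<^esub> k') h = \<phi> k (\<phi> k' h)"
    and "h \<in> carrier H \<Longrightarrow> \<phi> \<one>\<^bsub>K\<^esub> h = h"
    and "k \<in> carrier K \<Longrightarrow> \<phi> k \<one>\<^bsub>H\<^esub> = \<one>\<^bsub>H\<^esub>"
proof -
  have aut: "\<phi> k \<in> auto H" if "k \<in> carrier K" for k
    using hom_in_carrier[OF assms(3) that] by (simp add: AutoGroup_def)
  show hm: "\<phi> k \<in> hom H H" if "k \<in> carrier K" for k
    using aut[OF that] by (simp add: auto_def)
  show "\<phi> k h \<in> carrier H" if "k \<in> carrier K" "h \<in> carrier H" for k h
    using hm that by (meson hom_in_carrier)
  show "\<phi> k (h \<otimes>\<^bsub>H\<^esub> h') = \<phi> k h \<otimes>\<^bsub>H\<^esub> \<phi> k h'"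
    if "k \<in> carrier K" "h \<in> carrier H" "h' \<in> carrier H" for k h h'
    using hm that by (simp add: hom_mult)
  show "\<phi> (k \<otimes>\<^bsub>K\<^esub> k') h = \<phi> k (\<phi> k' h)"
    if "k \<in> carrier K" "k' \<in> carrier K" "h \<in> carrier H" for k k' h
  proof -
    have "\<phi> (k \<otimes>\<^bsub>K\<^esub> k') = \<phi> k \<otimes>\<^bsub>AutoGroup H\<^esub> \<phi> k'"
      using assms(3) that by (simp add: hom_mult)
    then show ?thesis
      using aut[OF that(1)] aut[OF that(2)] that(3)
      by (simp add: AutoGroup_def BijGroup_def auto_def compose_eq)
  qed
  show "\<phi> \<one>\<^bsub>K\<^esub> h = h" if "h \<in> carrier H" for h
  proof -
    have "\<phi> \<one>\<^bsub>K\<^esub> = \<one>\<^bsub>AutoGroup H\<^esub>"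
      using hom_one[OF assms(3) assms(2) group.AutoGroup[OF assms(1)]] .
    then show ?thesis using that by (simp add: AutoGroup_def BijGroup_def)
  qed
  show "\<phi> k \<one>\<^bsub>H\<^esub> = \<one>\<^bsub>H\<^esub>" if "k \<in> carrier K" for k
    using hom_one[OF hm[OF that] assms(1) assms(1)] .
qed

lemma semidirect_group:
  assumes "group H" "group K" "\<phi> \<in> hom K (AutoGroup H)"
  shows "group (semidirect H K \<phi>)"
proof -
  interpret H: group H by fact
  interpret K: group K by fact
  note [simp] = action_simps[OF assms]
  show ?thesis
  proof (rule groupI)
    fix x assume "x \<in> carrier (semidirect H K \<phi>)"
    then obtain h k where x: "x = (h, k)" and hk: "h \<in> carrier H" "k \<in> carrier K"
      by (auto simp: semidirect_def)
    have "\<phi> (inv\<^bsub>K\<^esub> k) (inv\<^bsub>H\<^esub> h) \<otimes>\<^bsub>H\<^esub> \<phi> (inv\<^bsub>K\<^esub> k) h = \<one>\<^bsub>H\<^esub>"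
      using hk by (simp flip: action_simps(3)[OF assms])
    then show "\<exists>y \<in> carrier (semidirect H K \<phi>). y \<otimes>\<^bsub>semidirect H K \<phi>\<^esub> x = \<one>\<^bsub>semidirect H K \<phi>\<^esub>"
      using hk
      by (intro bexI[of _ "(\<phi> (inv\<^bsub>K\<^esub> k) (inv\<^bsub>H\<^esub> h), inv\<^bsub>K\<^esub> k)"]) (auto simp: semidirect_def x)
  qed (auto simp: semidirect_def H.m_assoc K.m_assoc)
qed

lemma semidirect_conj:
  assumes "group H" "group K" "\<phi> \<in> hom K (AutoGroup H)" "h \<in> carrier H" "k \<in> carrier K"
  shows "emb_K H k \<otimes>\<^bsub>semidirect H K \<phi>\<^esub> emb_H K h \<otimes>\<^bsub>semidirect H K \<phi>\<^esub>
           inv\<^bsub>semidirect H K \<phi>\<^esub> (emb_K H k) = emb_H K (\<phi> k h)"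
proof -
  interpret H: group H by fact
  interpret K: group K by fact
  interpret G: group "semidirect H K \<phi>" by (rule semidirect_group) fact+
  note [simp] = action_simps[OF assms(1-3)]
  have "inv\<^bsub>semidirect H K \<phi>\<^esub> (emb_K H k) = emb_K H (inv\<^bsub>K\<^esub> k)"
    using assms(4,5) by (intro G.inv_equality) (auto simp: semidirect_def emb_K_def)
  then show ?thesis
    using assms(4,5) by (simp add: semidirect_def emb_K_def emb_H_def)
qed

lemma emb_mult:
  assumes "group H" "group K" "\<phi> \<in> hom K (AutoGroup H)" "h \<in> carrier H" "k \<in> carrier K"
  shows "emb_H K h \<otimes>\<^bsub>semidirect H K \<phi>\<^esub> emb_K H k = (h, k)"
proof -
  interpret H: group H by fact
  interpret K: group K by fact
  show ?thesis
    using assms(4,5) by (simp add: semidirect_def emb_K_def emb_H_def action_simps[OF assms(1-3)])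
qed

lemma has_matrix_exists:
  assumes "group H" "group K" "\<phi> \<in> hom K (AutoGroup H)"
    and "\<theta> \<in> hom (semidirect H K \<phi>) (semidirect H K \<phi>)"
  shows "\<exists>\<alpha> \<beta> \<gamma> \<delta>. has_matrix H K \<phi> \<theta> \<alpha> \<beta> \<gamma> \<delta>"
proof -
  interpret H: group H by fact
  interpret K: group K by fact
  have cl: "\<theta> x \<in> carrier H \<times> carrier K" if "x \<in> carrier H \<times> carrier K" for x
    using hom_in_carrier[OF assms(4), of x] that by (simp add: semidirect_def)
  have H: "\<theta> (emb_H K h) \<in> carrier H \<times> carrier K" if "h \<in> carrier H" for h
    using that by (intro cl) (simp add: emb_H_def)
  have K: "\<theta> (emb_K H k) \<in> carrier H \<times> carrier K" if "k \<in> carrier K" for k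
    using that by (intro cl) (simp add: emb_K_def)
  have "has_matrix H K \<phi> \<theta> (\<lambda>h. fst (\<theta> (emb_H K h))) (\<lambda>k. fst (\<theta> (emb_K H k)))
          (\<lambda>h. snd (\<theta> (emb_H K h))) (\<lambda>k. snd (\<theta> (emb_K H k)))"
    unfolding has_matrix_def using H K by (auto simp: mem_Times_iff emb_mult[OF assms(1-3)])
  then show ?thesis by blast
qed

end

(* With b = \<alpha>^-1 \<beta>, the elements b(k) and k of G have images with the same H-part \<beta>(k), so that
   \<theta>(b(k)^-1 k) = \<gamma>(b(k))^-1 \<delta>(k) = det_K(\<theta>)(k) lies in K. Up to the bijective change of coordinates
   (h, k) \<mapsto> h b(k)^-1 k on G, the map \<theta> is therefore the triangular map
   (h, k) \<mapsto> \<alpha>(h) \<gamma>(h) det_K(\<theta>)(k), which is bijective exactly if its two diagonal entries are. *)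

theory Submission
  imports Defs
begin

text \<open>Over each fixed \<open>y\<close> this is right translation by \<open>f y\<close>, undone
  by translation by \<open>inv (f y)\<close>. It supplies the change of coordinates on the
  semidirect product, with \<open>f\<close> sending \<open>k\<close> to the inverse of
  \<open>b k\<close>.\<close>

lemma (in group) bij_betw_mult_right_fibrewise:
  assumes "f \<in> B \<rightarrow> carrier G"
  shows "bij_betw (\<lambda>(x, y). (x \<otimes> f y, y)) (carrier G \<times> B) (carrier G \<times> B)"
  by (rule bij_betw_byWitness[where f' = "\<lambda>(x, y). (x \<otimes> inv (f y), y)"])
    (use assms in \<open>auto simp: m_assoc Pi_iff\<close>)

text \<open>The first coordinate determines \<open>x\<close> because \<open>\<alpha>\<close> is
  bijective; once \<open>x\<close> is known, the factor \<open>\<gamma> x\<close> cancels and only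
  \<open>D y\<close> remains. This is pure set-level triangularity: the argument treats
  \<open>\<alpha>\<close>, \<open>\<gamma>\<close> and \<open>D\<close> as mere maps, as it must
  because \<open>\<alpha>\<close> and the determinant are in general not homomorphisms.\<close>

lemma (in group) bij_betw_triangular_iff:
  assumes \<alpha>: "bij_betw \<alpha> A A'" and "A \<noteq> {}"
    and \<gamma>: "\<gamma> \<in> A \<rightarrow> carrier G" and D: "D \<in> B \<rightarrow> carrier G"
  shows "bij_betw (\<lambda>(x, y). (\<alpha> x, \<gamma> x \<otimes> D y)) (A \<times> B) (A' \<times> carrier G) \<longleftrightarrow>
    bij_betw D B (carrier G)"
    (is "bij_betw ?T _ _ \<longleftrightarrow> _")
proof
  assume T: "bij_betw ?T (A \<times> B) (A' \<times> carrier G)"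
  \<comment> \<open>On the slice over a single point \<open>a\<close>, the map is \<open>D\<close>
    followed by left translation by \<open>\<gamma> a\<close>, so both properties of
    \<open>D\<close> can be read off there.\<close>
  obtain a where a: "a \<in> A" using \<open>A \<noteq> {}\<close> by blast
  have \<gamma>a: "\<gamma> a \<in> carrier G" using a \<gamma> by blast
  show "bij_betw D B (carrier G)"
  proof (rule bij_betw_imageI)
    show "inj_on D B"
    proof (rule inj_onI)
      fix y y' assume "y \<in> B" "y' \<in> B" "D y = D y'"
      then show "y = y'"
        using inj_onD[OF bij_betw_imp_inj_on[OF T], of "(a, y)" "(a, y')"] a by simp
    qed
    have "z \<in> D ` B" if z: "z \<in> carrier G" for z
    proof -
      \<comment> \<open>The target is chosen so that any preimage lies over \<open>a\<close>, after
        which cancelling \<open>\<gamma> a\<close> leaves \<open>D y = z\<close>.\<close>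
      have "(\<alpha> a, \<gamma> a \<otimes> z) \<in> ?T ` (A \<times> B)"
        using a \<gamma>a z \<alpha> T by (auto simp: bij_betw_def)
      then obtain x y where xy: "x \<in> A" "y \<in> B" "\<alpha> x = \<alpha> a" "\<gamma> x \<otimes> D y = \<gamma> a \<otimes> z"
        by auto
      have "x = a" using xy a \<alpha> by (auto simp: bij_betw_def dest: inj_onD)
      then have "D y = z" using xy \<gamma>a z D by (metis PiE Units_eq Units_l_cancel)
      then show ?thesis using xy by blast
    qed
    then show "D ` B = carrier G" using D by auto
  qed
next
  assume bij: "bij_betw D B (carrier G)"
  show "bij_betw ?T (A \<times> B) (A' \<times> carrier G)"
  proof (rule bij_betw_imageI)
    show "inj_on ?T (A \<times> B)"
    proof (rule inj_onI, clarsimp)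
      fix x y x' y'
      assume xy: "x \<in> A" "y \<in> B" "x' \<in> A" "y' \<in> B" "\<alpha> x = \<alpha> x'" "\<gamma> x \<otimes> D y = \<gamma> x' \<otimes> D y'"
      have "x = x'" using xy \<alpha> by (auto simp: bij_betw_def dest: inj_onD)
      moreover from this have "D y = D y'"
        using xy \<gamma> D by (metis PiE Units_eq Units_l_cancel)
      ultimately show "x = x' \<and> y = y'"
        using xy bij by (auto simp: bij_betw_def dest: inj_onD)
    qed
    have "(w, z) \<in> ?T ` (A \<times> B)" if wz: "w \<in> A'" "z \<in> carrier G" for w z
    proof -
      obtain x where x: "x \<in> A" "\<alpha> x = w" using \<alpha> wz by (auto simp: bij_betw_def)
      then have \<gamma>x: "\<gamma> x \<in> carrier G" using \<gamma> by blast
      \<comment> \<open>This is the value that \<open>D y\<close> must take to solve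
        \<open>\<gamma> x \<otimes> D y = z\<close>.\<close>
      then have "inv (\<gamma> x) \<otimes> z \<in> D ` B" using bij wz by (auto simp: bij_betw_def)
      then obtain y where "y \<in> B" "D y = inv (\<gamma> x) \<otimes> z" by auto
      then have "?T (x, y) = (w, z)" using x \<gamma>x wz by (simp flip: m_assoc)
      then show ?thesis using x \<open>y \<in> B\<close> by (intro image_eqI[of _ _ "(x, y)"]) auto
    qed
    then show "?T ` (A \<times> B) = A' \<times> carrier G"
      using \<alpha> \<gamma> D by (auto simp: bij_betw_def)
  qed
qed

theorem theorem3p2:
  fixes H :: "('a, 'c) monoid_scheme" and K :: "('b, 'd) monoid_scheme"
    and \<phi> :: "'b \<Rightarrow> 'a \<Rightarrow> 'a"
    and \<theta> :: "'a \<times> 'b \<Rightarrow> 'a \<times> 'b"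
    and \<alpha> :: "'a \<Rightarrow> 'a" and \<beta> :: "'b \<Rightarrow> 'a" and \<gamma> :: "'a \<Rightarrow> 'b" and \<delta> :: "'b \<Rightarrow> 'b"
  assumes "group H" and "group K" and "\<phi> \<in> hom K (AutoGroup H)"
    and "\<theta> \<in> hom (semidirect H K \<phi>) (semidirect H K \<phi>)"
    and "has_matrix H K \<phi> \<theta> \<alpha> \<beta> \<gamma> \<delta>"
    and "bij_betw \<alpha> (carrier H) (carrier H)"
  shows "\<theta> \<in> iso (semidirect H K \<phi>) (semidirect H K \<phi>) \<longleftrightarrow>
    bij_betw (det_K H K \<alpha> \<beta> \<gamma> \<delta>) (carrier K) (carrier K)"
proof -
  interpret H: group H by fact
  interpret K: group K by fact
  let ?G = "semidirect H K \<phi>"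
  interpret G: group ?G by (rule semidirect_group) fact+
  note [simp] = action_simps[OF assms(1-3)]
  have carr: "carrier ?G = carrier H \<times> carrier K"
    by (simp add: semidirect_def)
  have mult: "(h, k) \<otimes>\<^bsub>?G\<^esub> (h', k') = (h \<otimes>\<^bsub>H\<^esub> \<phi> k h', k \<otimes>\<^bsub>K\<^esub> k')" for h k h' k'
    by (simp add: semidirect_def)
  have ty: "\<alpha> h \<in> carrier H" "\<gamma> h \<in> carrier K" if "h \<in> carrier H" for h
    using assms(5) that by (auto simp: has_matrix_def)
  have ty': "\<beta> k \<in> carrier H" "\<delta> k \<in> carrier K" if "k \<in> carrier K" for k
    using assms(5) that by (auto simp: has_matrix_def)
  have \<theta>H: "\<theta> (h, \<one>\<^bsub>K\<^esub>) = (\<alpha> h, \<gamma> h)" if "h \<in> carrier H" for h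
    using assms(5) that emb_mult[OF assms(1-3) ty[OF that]]
    unfolding has_matrix_def by (metis emb_H_def)
  have \<theta>K: "\<theta> (\<one>\<^bsub>H\<^esub>, k) = (\<beta> k, \<delta> k)" if "k \<in> carrier K" for k
    using assms(5) that emb_mult[OF assms(1-3) ty'[OF that]]
    unfolding has_matrix_def by (metis emb_K_def)
  have \<theta>_mult: "\<theta> (x \<otimes>\<^bsub>?G\<^esub> y) = \<theta> x \<otimes>\<^bsub>?G\<^esub> \<theta> y"
    if "x \<in> carrier ?G" "y \<in> carrier ?G" for x y
    using hom_mult[OF assms(4) that] .

  define b where "b = (\<lambda>k. inv_into (carrier H) \<alpha> (\<beta> k))"
  define D where "D = det_K H K \<alpha> \<beta> \<gamma> \<delta>"
  have b: "b k \<in> carrier H" "\<alpha> (b k) = \<beta> k" if "k \<in> carrier K" for k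
    using ty'(1)[OF that] assms(6)
    by (auto simp: b_def bij_betw_def inv_into_into f_inv_into_f)
  have D_eq: "D k = inv\<^bsub>K\<^esub> \<gamma> (b k) \<otimes>\<^bsub>K\<^esub> \<delta> k" for k
    by (simp add: D_def det_K_def map_add_def map_neg_def b_def)
  have D: "D k \<in> carrier K" if "k \<in> carrier K" for k
    using that by (simp add: D_eq ty ty' b)

  have \<theta>_b: "\<theta> (inv\<^bsub>H\<^esub> b k, k) = (\<one>\<^bsub>H\<^esub>, D k)" if k: "k \<in> carrier K" for k
  proof -
    \<comment> \<open>Since \<open>\<alpha>\<close> need not respect inverses, the image is not
      computed directly: multiplying on the left by the image of \<open>b k\<close> turns the
      argument into \<open>k\<close> itself, and the extra factor is cancelled in \<open>?G\<close>
      at the end.\<close>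
    have "(\<beta> k, \<gamma> (b k)) \<otimes>\<^bsub>?G\<^esub> \<theta> (inv\<^bsub>H\<^esub> b k, k) = \<theta> ((b k, \<one>\<^bsub>K\<^esub>) \<otimes>\<^bsub>?G\<^esub> (inv\<^bsub>H\<^esub> b k, k))"
      using k by (simp add: \<theta>_mult carr b \<theta>H)
    also have "\<dots> = (\<beta> k, \<delta> k)"
      using k by (simp add: mult b \<theta>K)
    also have "\<dots> = (\<beta> k, \<gamma> (b k)) \<otimes>\<^bsub>?G\<^esub> (\<one>\<^bsub>H\<^esub>, D k)"
      using k by (simp add: mult D_eq b ty ty' flip: K.m_assoc)
    finally show ?thesis
      using k hom_in_carrier[OF assms(4), of "(inv\<^bsub>H\<^esub> b k, k)"]
      by (subst (asm) G.Units_l_cancel) (auto simp: carr b ty ty' D)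
  qed

  let ?s = "\<lambda>(h, k). (h \<otimes>\<^bsub>H\<^esub> inv\<^bsub>H\<^esub> b k, k)"
  let ?T = "\<lambda>(h, k). (\<alpha> h, \<gamma> h \<otimes>\<^bsub>K\<^esub> D k)"
  have s: "bij_betw ?s (carrier ?G) (carrier ?G)"
    unfolding carr by (rule H.bij_betw_mult_right_fibrewise) (simp add: b)
  have \<theta>s: "(\<theta> \<circ> ?s) x = ?T x" if x: "x \<in> carrier ?G" for x
  proof -
    obtain h k where [simp]: "x = (h, k)" and hk: "h \<in> carrier H" "k \<in> carrier K"
      using x by (auto simp: carr)
    \<comment> \<open>Splitting off \<open>h\<close> on the left leaves a second factor whose image
      lies in \<open>K\<close>. Its \<open>H\<close>-part is trivial, so the action of
      \<open>\<gamma> h\<close> introduces no twist in the product.\<close>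
    have "\<theta> (h \<otimes>\<^bsub>H\<^esub> inv\<^bsub>H\<^esub> b k, k) = \<theta> ((h, \<one>\<^bsub>K\<^esub>) \<otimes>\<^bsub>?G\<^esub> (inv\<^bsub>H\<^esub> b k, k))"
      using hk by (simp add: mult b)
    also have "\<dots> = (\<alpha> h, \<gamma> h) \<otimes>\<^bsub>?G\<^esub> (\<one>\<^bsub>H\<^esub>, D k)"
      using hk by (simp add: \<theta>_mult carr b \<theta>H \<theta>_b)
    also have "\<dots> = (\<alpha> h, \<gamma> h \<otimes>\<^bsub>K\<^esub> D k)"
      using hk by (simp add: mult ty)
    finally show ?thesis by simp
  qed

  have "\<theta> \<in> iso ?G ?G \<longleftrightarrow> bij_betw \<theta> (carrier ?G) (carrier ?G)"
    using assms(4) by (simp add: iso_def)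
  also have "\<dots> \<longleftrightarrow> bij_betw (\<theta> \<circ> ?s) (carrier ?G) (carrier ?G)"
    by (rule bij_betw_comp_iff[OF s])
  also have "\<dots> \<longleftrightarrow> bij_betw ?T (carrier ?G) (carrier ?G)"
    by (rule bij_betw_cong) (rule \<theta>s)
  also have "\<dots> \<longleftrightarrow> bij_betw D (carrier K) (carrier K)"
    unfolding carr
    \<comment> \<open>The identity of \<open>H\<close> witnesses that the index set of the slices is
      nonempty.\<close>
    by (rule K.bij_betw_triangular_iff[OF assms(6)]) (use H.one_closed ty D in auto)
  finally show ?thesis unfolding D_def .
qed

end
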